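(* Let $F_j$ be the Fibonacci numbers ($F_1=F_2=1$), $I_n(x)=\prod_{i=1}^n\left(1+x^{F_{i+1}}\right)=\sum_{k\ge0}c_n(k)x^k$ for $n\ge0$. For $\alpha=(\alpha_0,\dots,\alpha_{m-1})\in\mathbb{N}^m$ define $$v_\alpha(n)=\sum_{k\ge0}c_n(k)^{\alpha_0}c_n(k+1)^{\alpha_1}\cdots c_n(k+m-1)^{\alpha_{m-1}}.$$ Then for every $\alpha\in\mathbb{N}^m$, the generating function $J_\alpha(x)=\sum_{n\ge0}v_\alpha(n)x^n$ is a rational function of $x$.
   Context: $\mathbb{N}=\{0,1,2,\dots\}$, and $0^0=1$. *)

theory Defs
  imports
    "HOL-Number_Theory.Fib"
    "HOL-Computational_Algebra.Polynomial_FPS"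
    "HOL-Analysis.Infinite_Sum"
begin

definition fib_prod :: "nat \<Rightarrow> nat poly" where
  "fib_prod n = (\<Prod>i=1..n. 1 + monom 1 (fib (i + 1)))"

definition fib_coeff :: "nat \<Rightarrow> nat \<Rightarrow> nat" where
  "fib_coeff n k = coeff (fib_prod n) k"

text \<open>
  A tuple in $N^m$ is a list of length $m$. If some entry of \<open>\<alpha>\<close> is nonzero, then only finitely
  many terms of the sum are nonzero. If all entries vanish (or \<open>\<alpha>\<close> is empty), every term is 1, the
  sum diverges, and the library convention for \<open>infsum\<close> assigns it the value 0.
\<close>

definition fib_corr :: "nat list \<Rightarrow> nat \<Rightarrow> nat" where
  "fib_corr \<alpha> n = (\<Sum>\<^sub>\<infinity>k\<in>UNIV. \<Prod>i<length \<alpha>. fib_coeff n (k + i) ^ (\<alpha> ! i))"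

definition fib_corr_gf :: "nat list \<Rightarrow> rat fps" where
  "fib_corr_gf \<alpha> = Abs_fps (\<lambda>n. of_nat (fib_corr \<alpha> n))"

text \<open>
  A rational function lies in the ring of formal power series iff it can be written with a
  denominator whose constant term is nonzero, i.e. one that is a unit there.
\<close>

definition rational_fps :: "'a::field fps \<Rightarrow> bool" where
  "rational_fps F \<longleftrightarrow> (\<exists>P Q. coeff Q 0 \<noteq> 0 \<and> F = fps_of_poly P / fps_of_poly Q)"

end

theory Submission imports Defs begin

text \<open>
  Write the correlation as \<open>W n s = (\<Sum>k. c n k * (\<Prod>j. c n (k + s j)))\<close> for a vector of shifts \<open>s\<close>.
  The recurrence \<open>c (n + 1) k = c n k + c n (k - F (n + 2))\<close> turns \<open>W (n + 1) s\<close> into a sum of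
  \<open>W n s'\<close>, where \<open>s' j - s j\<close> is \<open>-F (n + 2)\<close>, \<open>0\<close> or \<open>F (n + 2)\<close>. In the coordinates
  \<open>s j = \<delta> j - a j * F (n + 2) - b j * F (n + 1)\<close> this becomes the map
  \<open>(a, b) \<mapsto> (a + b + d, a)\<close> with \<open>\<bar>d\<bar> \<le> 1\<close>, which no longer depends on \<open>n\<close>. Along the contracting
  eigendirection of the Fibonacci matrix such orbits stay bounded; along the expanding one, a large
  \<open>(a, b)\<close> makes \<open>s j\<close> exceed the degree of the polynomial, so that \<open>W\<close> vanishes. Hence finitely
  many states matter, and their generating functions solve a finite linear system over the
  rational power series.
\<close>

section \<open>Rational power series\<close>

lemma rational_fps_iff:
  fixes F :: "'a::field fps"
  shows "rational_fps F \<longleftrightarrow> (\<exists>P Q. coeff Q 0 \<noteq> 0 \<and> F * fps_of_poly Q = fps_of_poly P)"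
proof -
  have "F = fps_of_poly P / fps_of_poly Q \<longleftrightarrow> F * fps_of_poly Q = fps_of_poly P"
    if "coeff Q 0 \<noteq> 0" for P Q :: "'a poly"
  proof -
    have inv: "fps_of_poly Q * inverse (fps_of_poly Q) = 1"
      using that by (intro inverse_mult_eq_1') simp
    have "fps_of_poly P / fps_of_poly Q = fps_of_poly P * inverse (fps_of_poly Q)"
      using that by (intro fps_divide_unit) simp
    with inv show ?thesis
      by (metis (no_types, lifting) mult.assoc mult.commute mult_1_right)
  qed
  then show ?thesis unfolding rational_fps_def by blast
qed

lemma rational_fps_of_poly: "rational_fps (fps_of_poly P)"
  unfolding rational_fps_iff by (intro exI[of _ P] exI[of _ 1]) simp

lemma rational_fps_const: "rational_fps (fps_const c)"
  using rational_fps_of_poly[of "[:c:]"] by (simp add: fps_of_poly_const)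

lemma rational_fps_X: "rational_fps fps_X"
  using rational_fps_of_poly[of "[:0, 1:]"] by (simp add: fps_of_poly_pCons)

lemma rational_fps_add:
  assumes "rational_fps F" "rational_fps G"
  shows "rational_fps (F + G)"
proof -
  obtain P Q R T where *: "coeff Q 0 \<noteq> 0" "F * fps_of_poly Q = fps_of_poly P"
      "coeff T 0 \<noteq> 0" "G * fps_of_poly T = fps_of_poly R"
    using assms unfolding rational_fps_iff by blast
  have "(F + G) * fps_of_poly (Q * T)
      = (F * fps_of_poly Q) * fps_of_poly T + (G * fps_of_poly T) * fps_of_poly Q"
    by (simp add: fps_of_poly_mult algebra_simps)
  also have "\<dots> = fps_of_poly (P * T + R * Q)"
    by (simp add: * fps_of_poly_mult fps_of_poly_add)
  finally have "(F + G) * fps_of_poly (Q * T) = fps_of_poly (P * T + R * Q)" .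
  moreover have "coeff (Q * T) 0 \<noteq> 0" using * by (simp add: coeff_mult)
  ultimately show ?thesis unfolding rational_fps_iff by blast
qed

lemma rational_fps_mult:
  assumes "rational_fps F" "rational_fps G"
  shows "rational_fps (F * G)"
proof -
  obtain P Q R T where *: "coeff Q 0 \<noteq> 0" "F * fps_of_poly Q = fps_of_poly P"
      "coeff T 0 \<noteq> 0" "G * fps_of_poly T = fps_of_poly R"
    using assms unfolding rational_fps_iff by blast
  have "(F * G) * fps_of_poly (Q * T) = (F * fps_of_poly Q) * (G * fps_of_poly T)"
    by (simp add: fps_of_poly_mult algebra_simps)
  then have "(F * G) * fps_of_poly (Q * T) = fps_of_poly (P * R)"
    by (simp add: * fps_of_poly_mult)
  moreover have "coeff (Q * T) 0 \<noteq> 0" using * by (simp add: coeff_mult)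
  ultimately show ?thesis unfolding rational_fps_iff by blast
qed

lemma rational_fps_diff:
  assumes "rational_fps F" "rational_fps G"
  shows "rational_fps (F - G)"
proof -
  have "rational_fps (F + fps_const (-1) * G)"
    by (intro rational_fps_add rational_fps_mult rational_fps_const assms)
  then show ?thesis by (simp flip: fps_const_neg)
qed

lemma rational_fps_sum:
  "(\<And>x. x \<in> A \<Longrightarrow> rational_fps (f x)) \<Longrightarrow> rational_fps (\<Sum>x\<in>A. f x)"
proof (induction A rule: infinite_finite_induct)
  case (insert x A)
  then show ?case by (simp add: rational_fps_add)
qed (use rational_fps_const[of 0] in simp_all)

lemma rational_fps_inverse:
  assumes "rational_fps F" "fps_nth F 0 \<noteq> 0"
  shows "rational_fps (inverse F)"
proof -
  obtain P Q where *: "coeff Q 0 \<noteq> 0" "F * fps_of_poly Q = fps_of_poly P"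
    using assms unfolding rational_fps_iff by blast
  have "fps_nth (F * fps_of_poly Q) 0 \<noteq> 0" using *(1) assms(2) by simp
  then have "coeff P 0 \<noteq> 0" unfolding *(2) by simp
  moreover have "inverse F * fps_of_poly P = fps_of_poly Q"
    using inverse_mult_eq_1[OF assms(2)] by (simp flip: *(2) mult.assoc)
  ultimately show ?thesis unfolding rational_fps_iff by blast
qed

text \<open>Gaussian elimination: each pivot \<open>1 - X m\<close> is a unit, so no division can fail.\<close>

lemma rational_fps_linear_system:
  fixes G :: "'s \<Rightarrow> 'a::field fps"
  assumes "finite S"
    and "\<And>p. p \<in> S \<Longrightarrow> rational_fps (r p)"
    and "\<And>p q. p \<in> S \<Longrightarrow> q \<in> S \<Longrightarrow> rational_fps (m p q)"
    and "\<And>p. p \<in> S \<Longrightarrow> G p = r p + (\<Sum>q\<in>S. fps_X * m p q * G q)"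
    and "p \<in> S"
  shows "rational_fps (G p)"
  using assms
proof (induction S arbitrary: r m p rule: finite_induct)
  case empty
  then show ?case by simp
next
  case (insert a S)
  note r = insert.prems(1) and m = insert.prems(2) and G = insert.prems(3)
  define u where "u = inverse (1 - fps_X * m a a)"
  have "fps_nth (1 - fps_X * m a a) 0 \<noteq> 0" by simp
  moreover have "rational_fps (1 - fps_X * m a a)"
    using rational_fps_const[of 1]
    by (intro rational_fps_diff rational_fps_mult rational_fps_X m) auto
  ultimately have u: "rational_fps u" and u1: "u * (1 - fps_X * m a a) = 1"
    unfolding u_def by (auto intro: rational_fps_inverse inverse_mult_eq_1)
  have "G a = r a + fps_X * m a a * G a + (\<Sum>q\<in>S. fps_X * m a q * G q)"
    using G[of a] insert.hyps by (simp add: add.assoc)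
  then have "(1 - fps_X * m a a) * G a = r a + (\<Sum>q\<in>S. fps_X * m a q * G q)"
    by (simp add: algebra_simps)
  then have Ga: "G a = u * (r a + (\<Sum>q\<in>S. fps_X * m a q * G q))"
    using u1 by (metis mult.assoc mult_1)
  have rat: "rational_fps (G q)" if "q \<in> S" for q
  \<comment> \<open>Substituting \<open>Ga\<close> leaves coefficients that still carry a factor
    \<open>fps_X\<close>, so the reduced system has the same shape and its pivots stay
    units.\<close>
  proof (rule insert.IH[where r = "\<lambda>p. r p + fps_X * m p a * u * r a"
        and m = "\<lambda>p q. m p q + fps_X * m p a * u * m a q", OF _ _ _ that])
    fix p assume p: "p \<in> S"
    show "rational_fps (r p + fps_X * m p a * u * r a)"
      using p by (intro rational_fps_add rational_fps_mult rational_fps_X r m u) auto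
    show "rational_fps (m p q + fps_X * m p a * u * m a q)" if "q \<in> S" for q
      using p that by (intro rational_fps_add rational_fps_mult rational_fps_X m u) auto
    have "G p = r p + (\<Sum>q\<in>S. fps_X * m p q * G q) + fps_X * m p a * G a"
      using G[of p] p insert.hyps by (simp add: algebra_simps)
    also have "\<dots> = r p + fps_X * m p a * u * r a
        + ((\<Sum>q\<in>S. fps_X * m p q * G q) + (\<Sum>q\<in>S. fps_X * m p a * u * (fps_X * m a q * G q)))"
      by (subst Ga) (simp add: distrib_left mult.assoc add_ac sum_distrib_left)
    also have "\<dots> = r p + fps_X * m p a * u * r a
        + (\<Sum>q\<in>S. fps_X * (m p q + fps_X * m p a * u * m a q) * G q)"
      by (simp add: algebra_simps flip: sum.distrib)
    finally show "G p = r p + fps_X * m p a * u * r a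
        + (\<Sum>q\<in>S. fps_X * (m p q + fps_X * m p a * u * m a q) * G q)" .
  qed
  have "rational_fps (G a)"
    unfolding Ga
    by (intro rational_fps_mult rational_fps_add rational_fps_sum rational_fps_X u r m rat) auto
  with rat insert.prems(4) show ?case by auto
qed

lemma Abs_fps_unfold:
  fixes u :: "nat \<Rightarrow> 'a::field"
  shows "Abs_fps u = fps_const (u 0) + fps_X * Abs_fps (\<lambda>n. u (Suc n))"
  by (rule fps_ext) simp

text \<open>Peeling off leading coefficients leaves a constant sequence, whose series solves the
  one-unknown system \<open>G = c + X G\<close>.\<close>

lemma rational_fps_eventually_const:
  fixes u :: "nat \<Rightarrow> 'a::field"
  assumes "\<And>n. n \<ge> k \<Longrightarrow> u n = c"
  shows "rational_fps (Abs_fps u)"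
  using assms
proof (induction k arbitrary: u)
  case 0
  then have "u = (\<lambda>_. c)" by auto
  then have "Abs_fps u = fps_const c + fps_X * Abs_fps u"
    using Abs_fps_unfold[of u] by simp
  then show ?case
    using rational_fps_const[of c] rational_fps_const[of 1]
    by (intro rational_fps_linear_system[where S = "{()}" and G = "\<lambda>_. Abs_fps u"
          and r = "\<lambda>_. fps_const c" and m = "\<lambda>_ _. 1"]) auto
next
  case (Suc k)
  have "rational_fps (Abs_fps (\<lambda>n. u (Suc n)))"
    using Suc.prems by (intro Suc.IH) simp
  then show ?case
    by (subst Abs_fps_unfold)
      (intro rational_fps_add rational_fps_mult rational_fps_X rational_fps_const)
qed

text \<open>Transfer-matrix method: grouping the moves \<open>d\<close> by target gives a linear
  system. Moves may leave \<open>S\<close>, but by \<open>out\<close> only to states that contribute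
  0.\<close>

lemma rational_fps_transfer:
  fixes N :: "nat \<Rightarrow> 's \<Rightarrow> 'a::field" and f :: "'s \<Rightarrow> 'd \<Rightarrow> 's"
  assumes S: "finite S" and D: "finite D"
    and rec: "\<And>n p. p \<in> S \<Longrightarrow> N (Suc n) p = (\<Sum>d\<in>D. N n (f p d))"
    and out: "\<And>n p d. p \<in> S \<Longrightarrow> d \<in> D \<Longrightarrow> f p d \<notin> S \<Longrightarrow> N n (f p d) = 0"
    and p: "p \<in> S"
  shows "rational_fps (Abs_fps (\<lambda>n. N n p))"
proof (rule rational_fps_linear_system[OF S _ _ _ p])
  fix p assume p: "p \<in> S"
  let ?m = "\<lambda>p q. of_nat (card {d \<in> D. f p d = q}) :: 'a"
  have "N (Suc n) p = (\<Sum>q\<in>S. ?m p q * N n q)" for n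
  proof -
    have "N (Suc n) p = (\<Sum>d\<in>D. \<Sum>q\<in>S. if f p d = q then N n q else 0)"
      using S out[OF p] by (auto simp: rec[OF p] intro!: sum.cong)
    also have "\<dots> = (\<Sum>q\<in>S. \<Sum>d\<in>D. if f p d = q then N n q else 0)"
      by (rule sum.swap)
    also have "\<dots> = (\<Sum>q\<in>S. ?m p q * N n q)"
      using D by (intro sum.cong refl) (simp add: sum.If_cases Int_def conj_commute)
    finally show ?thesis .
  qed
  then have "Abs_fps (\<lambda>n. N (Suc n) p) = (\<Sum>q\<in>S. fps_const (?m p q) * Abs_fps (\<lambda>n. N n q))"
    by (intro fps_ext) (simp add: fps_sum_nth)
  then show "Abs_fps (\<lambda>n. N n p) = fps_const (N 0 p)
      + (\<Sum>q\<in>S. fps_X * fps_const (?m p q) * Abs_fps (\<lambda>n. N n q))"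
    by (subst Abs_fps_unfold) (simp add: mult.assoc flip: sum_distrib_left)
qed (rule rational_fps_const)+

section \<open>Correlations of the coefficients\<close>

text \<open>Extension by zero to negative indices, so that shifts avoid truncated
  subtraction.\<close>

definition fib_coeff_int :: "nat \<Rightarrow> int \<Rightarrow> nat" where
  "fib_coeff_int n z = (if z < 0 then 0 else fib_coeff n (nat z))"

lemma fib_coeff_int_of_nat [simp]: "fib_coeff_int n (int k) = fib_coeff n k"
  by (simp add: fib_coeff_int_def)

lemma fib_coeff_int_Suc:
  "fib_coeff_int (Suc n) z = fib_coeff_int n z + fib_coeff_int n (z - int (fib (n + 2)))"
proof -
  have "fib_prod (Suc n) = fib_prod n + monom 1 (fib (n + 2)) * fib_prod n"
    by (simp add: fib_prod_def algebra_simps)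
  then have "fib_coeff (Suc n) k
      = fib_coeff n k + (if k < fib (n + 2) then 0 else fib_coeff n (k - fib (n + 2)))" for k
    by (simp add: fib_coeff_def coeff_monom_mult)
  then show ?thesis
    by (auto simp: fib_coeff_int_def nat_diff_distrib simp del: fib.simps)
qed

text \<open>The degree is \<open>fib 2 + ... + fib (n + 1) = fib (n + 3) - 2\<close>.\<close>

lemma fib_coeff_int_eq_0: "z < 0 \<or> z \<ge> int (fib (n + 3)) \<Longrightarrow> fib_coeff_int n z = 0"
proof (induction n arbitrary: z)
  case 0
  then show ?case
    by (auto simp: fib_coeff_int_def fib_coeff_def fib_prod_def numeral_3_eq_3)
next
  case (Suc n)
  have "fib (Suc n + 3) = fib (n + 3) + fib (n + 2)"
    by (simp add: numeral_3_eq_3)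
  with Suc show ?case by (auto simp: fib_coeff_int_Suc)
qed

lemma less_fib_add_2: "n < fib (n + 2)"
proof (induction n)
  case (Suc n)
  have "fib (n + 1) > 0" by (simp add: fib_neq_0_nat)
  with Suc show ?case by simp
qed simp

text \<open>Passing from \<open>n\<close> to \<open>Suc n\<close> adds a factor with exponent
  \<open>fib (n + 2) > n\<close>, too large to affect coefficients up to \<open>n\<close>.\<close>

lemma fib_coeff_int_stable: "int n \<ge> z \<Longrightarrow> fib_coeff_int n z = fib_coeff_int (nat z) z"
proof (cases "z < 0")
  case False
  assume "int n \<ge> z"
  then have "nat z \<le> n" by simp
  then show ?thesis
  proof (induction n rule: dec_induct)
    case (step n)
    have "z - int (fib (n + 2)) < 0" using less_fib_add_2[of n] step.hyps by linarith
    then show ?case using step.IH 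
      by (simp only: fib_coeff_int_Suc fib_coeff_int_eq_0 simp_thms add_0_right)
  qed simp
qed (simp add: fib_coeff_int_eq_0)

text \<open>One factor is pinned at shift 0; \<open>J\<close> indexes the others, with repetition to
  encode powers. The window contains the support of the pinned factor.\<close>

definition shift_corr :: "'j set \<Rightarrow> nat \<Rightarrow> ('j \<Rightarrow> int) \<Rightarrow> nat" where
  "shift_corr J n s =
     (\<Sum>k\<in>{0..<int (fib (n + 3))}. fib_coeff_int n k * (\<Prod>j\<in>J. fib_coeff_int n (k + s j)))"

lemma shift_corr_superset:
  assumes "finite K" "{0..<int (fib (n + 3))} \<subseteq> K"
  shows "shift_corr J n s =
    (\<Sum>k\<in>K. fib_coeff_int n k * (\<Prod>j\<in>J. fib_coeff_int n (k + s j)))"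
  unfolding shift_corr_def
  using assms by (intro sum.mono_neutral_left) (auto simp: fib_coeff_int_eq_0)

lemma shift_corr_cong: "(\<And>j. j \<in> J \<Longrightarrow> s j = t j) \<Longrightarrow> shift_corr J n s = shift_corr J n t"
  unfolding shift_corr_def by (intro sum.cong arg_cong2[of _ _ _ _ "(*)"] prod.cong) auto

lemma shift_corr_eq_0:
  assumes "finite J" "j \<in> J" "\<bar>s j\<bar> \<ge> int (fib (n + 3))"
  shows "shift_corr J n s = 0"
  unfolding shift_corr_def
proof (intro sum.neutral ballI)
  fix k assume "k \<in> {0..<int (fib (n + 3))}"
  then have "fib_coeff_int n (k + s j) = 0"
    using assms(3) by (intro fib_coeff_int_eq_0) auto
  then show "fib_coeff_int n k * (\<Prod>j\<in>J. fib_coeff_int n (k + s j)) = 0"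
    using assms(1,2) by auto
qed

text \<open>The recurrence splits every factor in two: \<open>e\<close> tells whether the pinned
  factor takes the displaced term, \<open>E\<close> which of the others do. After recentring only
  the relative displacement remains.\<close>

lemma shift_corr_Suc:
  assumes J: "finite J"
  shows "shift_corr J (Suc n) s = (\<Sum>(e, E)\<in>{0, 1} \<times> Pow J.
    shift_corr J n (\<lambda>j. s j + (e - of_bool (j \<in> E)) * int (fib (n + 2))))"
proof -
  let ?c = "fib_coeff_int n"
  define F where "F = int (fib (n + 2))"
  define K where "K = {0..<int (fib (Suc n + 3))}"
  have fib: "int (fib (Suc n + 3)) = int (fib (n + 3)) + F"
    by (simp add: numeral_3_eq_3 F_def)
  have expand: "(\<Prod>j\<in>J. ?c (z + s j) + ?c (z + s j - F))
      = (\<Sum>E\<in>Pow J. \<Prod>j\<in>J. ?c (z + s j - of_bool (j \<in> E) * F))" for z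
  proof -
    have "(\<Prod>j\<in>E. ?c (z + s j - F)) * (\<Prod>j\<in>J - E. ?c (z + s j))
        = (\<Prod>j\<in>J. ?c (z + s j - of_bool (j \<in> E) * F))" if "E \<subseteq> J" for E
      using that J by (subst prod.subset_diff[of E J]) (auto intro: prod.cong simp: mult.commute)
    then show ?thesis
      using J by (subst add.commute) (simp add: prod_add)
  qed
  let ?P = "\<lambda>k e E. \<Prod>j\<in>J. ?c (k + (s j + (e - of_bool (j \<in> E)) * F))"
  have 0: "(\<Sum>k\<in>K. ?c k * ?P k 0 E)
      = shift_corr J n (\<lambda>j. s j + (0 - of_bool (j \<in> E)) * F)" for E
    by (rule shift_corr_superset[symmetric]) (simp_all only: K_def fib, auto simp: F_def)
  \<comment> \<open>Translating \<open>k\<close> by \<open>F\<close> recentres the pinned factor;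
    the extra indices below 0 contribute nothing.\<close>
  have 1: "(\<Sum>k\<in>K. ?c (k - F) * ?P (k - F) 1 E)
      = shift_corr J n (\<lambda>j. s j + (1 - of_bool (j \<in> E)) * F)" for E
  proof -
    have "(\<Sum>k\<in>K. ?c (k - F) * ?P (k - F) 1 E) = (\<Sum>k\<in>(\<lambda>k. k - F) ` K. ?c k * ?P k 1 E)"
      by (subst sum.reindex) (auto simp: inj_on_def)
    also have "(\<lambda>k. k - F) ` K = {-F..<int (fib (n + 3))}"
      using image_add_atLeastLessThan'[of "- F" 0 "int (fib (n + 3)) + F"]
      unfolding K_def fib by simp
    also have "(\<Sum>k\<in>{-F..<int (fib (n + 3))}. ?c k * ?P k 1 E)
        = shift_corr J n (\<lambda>j. s j + (1 - of_bool (j \<in> E)) * F)"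
      by (subst shift_corr_superset[of "{-F..<int (fib (n + 3))}"]) (auto simp: F_def)
    finally show ?thesis .
  qed
  have "shift_corr J (Suc n) s
      = (\<Sum>k\<in>K. (?c k + ?c (k - F)) * (\<Prod>j\<in>J. ?c (k + s j) + ?c (k + s j - F)))"
    unfolding shift_corr_def K_def fib_coeff_int_Suc F_def ..
  also have "\<dots> = (\<Sum>k\<in>K. \<Sum>E\<in>Pow J. ?c k * ?P k 0 E + ?c (k - F) * ?P (k - F) 1 E)"
    unfolding expand sum_distrib_left
    by (intro sum.cong refl) (simp add: algebra_simps)
  also have "\<dots> = (\<Sum>E\<in>Pow J. (\<Sum>k\<in>K. ?c k * ?P k 0 E) + (\<Sum>k\<in>K. ?c (k - F) * ?P (k - F) 1 E))"
    by (subst sum.swap) (simp add: sum.distrib)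
  also have "\<dots> = (\<Sum>e\<in>{0, 1}. \<Sum>E\<in>Pow J. shift_corr J n (\<lambda>j. s j + (e - of_bool (j \<in> E)) * F))"
    unfolding 0 1 by (simp add: sum.distrib)
  also have "\<dots> = (\<Sum>(e, E)\<in>{0, 1} \<times> Pow J. shift_corr J n (\<lambda>j. s j + (e - of_bool (j \<in> E)) * F))"
    by (rule sum.cartesian_product)
  finally show ?thesis unfolding F_def .
qed

section \<open>Finiteness of the state space\<close>

definition golden :: real where "golden = (1 + sqrt 5) / 2"

lemma golden_square: "golden * golden = golden + 1"
  by (simp add: golden_def field_simps)

lemma golden_gt: "golden > 3 / 2"
proof -
  have "sqrt 5 > 2" by (rule real_less_rsqrt) simp
  then show ?thesis by (simp add: golden_def)
qed

text \<open>
  \<open>(1 - golden, 1)\<close> is the left eigenvector of \<open>(a, b) \<mapsto> (a + b, a)\<close> for the eigenvalue \<open>1 - golden\<close> of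
  modulus below 1, and the bound \<open>golden\<close> is the fixed point of \<open>x \<mapsto> (golden - 1) * (x + 1)\<close>.
\<close>

definition near_contracting :: "int \<times> int \<Rightarrow> bool" where
  "near_contracting p \<longleftrightarrow> \<bar>(1 - golden) * of_int (fst p) + of_int (snd p)\<bar> \<le> golden"

lemma near_contracting_step:
  assumes "near_contracting (a, b)" "\<bar>d\<bar> \<le> 1"
  shows "near_contracting (a + b + d, a)"
proof -
  let ?L = "(1 - golden) * of_int a + of_int b"
  \<comment> \<open>\<open>1 - golden\<close> is the other root of
    \<open>x * x = x + 1\<close>.\<close>
  have "(1 - golden) * of_int (a + b + d) + of_int a = (1 - golden) * (?L + of_int d)"
    unfolding of_int_add using golden_square by algebra
  also have "\<bar>\<dots>\<bar> = (golden - 1) * \<bar>?L + of_int d\<bar>"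
    using golden_gt by (simp add: abs_mult)
  also have "\<dots> \<le> (golden - 1) * (golden + 1)"
  proof (rule mult_left_mono)
    have "\<bar>of_int d :: real\<bar> \<le> 1" using assms(2) by linarith
    then show "\<bar>?L + of_int d\<bar> \<le> golden + 1"
      using assms(1) by (simp add: near_contracting_def)
  qed (use golden_gt in simp)
  also have "\<dots> = golden"
    using golden_square by (simp add: algebra_simps)
  finally show ?thesis by (simp add: near_contracting_def)
qed

lemma near_contracting_uminus: "near_contracting (- a, - b) \<longleftrightarrow> near_contracting (a, b)"
proof -
  have "(1 - golden) * of_int (- a) + of_int (- b) = - ((1 - golden) * of_int a + of_int b)"
    by simp
  then show ?thesis unfolding near_contracting_def fst_conv snd_conv by (metis abs_minus_cancel)
qed

text \<open>\<open>b\<close> lies within \<open>golden\<close> of \<open>(golden - 1) * a\<close>,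
  and \<open>5 * (golden - 1) > golden\<close>.\<close>

lemma near_contracting_nonneg:
  assumes "near_contracting (a, b)" "a \<ge> 5"
  shows "b \<ge> 0"
proof -
  have "(golden - 1) * 5 \<le> (golden - 1) * of_int a"
    using golden_gt assms(2) by (intro mult_left_mono) auto
  moreover have "\<bar>of_int b - (golden - 1) * of_int a\<bar> \<le> golden"
    using assms(1) by (simp add: near_contracting_def algebra_simps)
  ultimately have "(of_int b :: real) > 0"
    using golden_gt by argo
  then show ?thesis by simp
qed

text \<open>For large \<open>a\<close>, \<open>b\<close> cannot have the opposite sign, so the
  Fibonacci terms do not cancel: together they reach \<open>2 * F + D\<close> in modulus.
  Subtracting at most \<open>D\<close> for \<open>d\<close> leaves
  \<open>2 * F \<ge> F + F'\<close>.\<close>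

lemma near_contracting_large:
  assumes "near_contracting (a, b)" "\<bar>a\<bar> \<ge> D + 5" "D \<ge> 0" "\<bar>d\<bar> \<le> D"
  shows "\<bar>d - a * int (fib (n + 2)) - b * int (fib (n + 1))\<bar> \<ge> int (fib (n + 3))"
proof -
  define F F' where "F = int (fib (n + 2))" and "F' = int (fib (n + 1))"
  have F: "F \<ge> 1" "F' \<ge> 0" "F' \<le> F" "int (fib (n + 3)) = F + F'"
    using fib_neq_0_nat[of "n + 2"] by (auto simp: F_def F'_def numeral_3_eq_3)
  have *: "a * F + b * F' \<ge> 2 * F + D" if "near_contracting (a, b)" "a \<ge> D + 5" for a b
  proof -
    have "b \<ge> 0" using near_contracting_nonneg[OF that(1)] that(2) assms(3) by simp
    then have "b * F' \<ge> 0" using F by simp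
    moreover have "a * F \<ge> (D + 2) * F" using that F by (intro mult_right_mono) auto
    moreover have "D * F \<ge> D * 1" using F assms(3) by (intro mult_left_mono) auto
    ultimately show ?thesis by (simp add: algebra_simps)
  qed
  have "\<bar>d - a * F - b * F'\<bar> \<ge> F + F'"
  proof (cases "a \<ge> 0")
    case True
    then show ?thesis using *[of a b] assms F by simp
  next
    case False
    then show ?thesis using *[of "- a" "- b"] assms F near_contracting_uminus by simp
  qed
  then show ?thesis by (simp only: F F_def F'_def)
qed

lemma rational_fps_shift_corr:
  assumes J: "finite J"
  shows "rational_fps (Abs_fps (\<lambda>n. of_nat (shift_corr J n \<delta>)) :: 'a::field fps)"
proof -
  define D where "D = (\<Sum>j\<in>J. \<bar>\<delta> j\<bar>)"
  have D: "\<bar>\<delta> j\<bar> \<le> D" if "j \<in> J" for j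
    using J that unfolding D_def by (auto intro: member_le_sum)
  have D0: "D \<ge> 0" unfolding D_def by (rule sum_nonneg) simp
  \<comment> \<open>The cutoff \<open>D + 4\<close> complements the \<open>D + 5\<close> beyond
    which correlations vanish; \<open>near_contracting\<close> then bounds the second coordinate as
    well.\<close>
  define T where "T = {p. near_contracting p \<and> \<bar>fst p\<bar> \<le> D + 4}"
  have "T \<subseteq> {-(D + 4)..D + 4} \<times> {-(D + 8)..D + 8}"
  proof safe
    fix a b assume "(a, b) \<in> T"
    then have nc: "near_contracting (a, b)" and a: "\<bar>a\<bar> \<le> D + 4" by (auto simp: T_def)
    show "a \<in> {-(D + 4)..D + 4}" using a by auto
    have g: "golden < 2"
    proof -
      have "sqrt 5 < 3" by (rule real_less_lsqrt) auto
      then show ?thesis by (simp add: golden_def)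
    qed
    have "\<bar>(1 - golden) * of_int a\<bar> \<le> 1 * \<bar>of_int a :: real\<bar>"
      unfolding abs_mult using golden_gt g by (intro mult_right_mono) auto
    then have "\<bar>of_int b :: real\<bar> \<le> of_int (D + 8)"
      using nc a g unfolding near_contracting_def fst_conv snd_conv by linarith
    then show "b \<in> {-(D + 8)..D + 8}" by auto
  qed
  then have finT: "finite T" by (rule finite_subset) auto
  define S where "S = (\<Pi>\<^sub>E j\<in>J. T)"
  define s where "s = (\<lambda>n p j. \<delta> j - fst (p j) * int (fib (n + 2)) - snd (p j) * int (fib (n + 1)))"
  \<comment> \<open>The displacement changes sign because \<open>fst (p j)\<close> enters
    \<open>s\<close> negatively; one \<open>e\<close> is shared by all coordinates.\<close>
  define step where "step = (\<lambda>p (e, E). \<lambda>j\<in>J.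
    (fst (p j) + snd (p j) + (of_bool (j \<in> E) - e), fst (p j) :: int))"
  \<comment> \<open>The zero state represents \<open>\<delta>\<close> at every
    \<open>n\<close>.\<close>
  define start where "start = (\<lambda>j\<in>J. (0::int, 0::int))"
  have "rational_fps (Abs_fps (\<lambda>n. of_nat (shift_corr J n (s n start)) :: 'a))"
  proof (rule rational_fps_transfer[where S = S and D = "{0, 1} \<times> Pow J" and f = step])
    show "finite S" unfolding S_def using J finT by (intro finite_PiE)
    show "finite ({0, 1::int} \<times> Pow J)" using J by simp
    show "start \<in> S"
      using D0 golden_gt by (auto simp: start_def S_def T_def near_contracting_def)
  next
    fix n p
    have "shift_corr J (Suc n) (s (Suc n) p)
        = (\<Sum>d\<in>{0, 1} \<times> Pow J. shift_corr J n (s n (step p d)))"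
      unfolding shift_corr_Suc[OF J]
    proof (intro sum.cong refl, clarify intro!: shift_corr_cong)
      fix e E j assume "j \<in> J"
      then show "s (Suc n) p j + (e - of_bool (j \<in> E)) * int (fib (n + 2)) = s n (step p (e, E)) j"
        by (simp add: s_def step_def algebra_simps)
    qed
    then show "of_nat (shift_corr J (Suc n) (s (Suc n) p))
        = (\<Sum>d\<in>{0, 1} \<times> Pow J. of_nat (shift_corr J n (s n (step p d))) :: 'a)"
      by simp
  next
    fix n p d
    assume p: "p \<in> S" and d: "d \<in> {0, 1} \<times> Pow J" and notin: "step p d \<notin> S"
    \<comment> \<open>Being extensional, \<open>step p d\<close> can leave \<open>S\<close> only
      through a coordinate; that one is still near contracting, so it has passed the cutoff.\<close>
    have "step p d \<in> extensional J" by (auto simp: step_def split: prod.splits)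
    with notin obtain j where j: "j \<in> J" "step p d j \<notin> T"
      by (auto simp: S_def PiE_def)
    obtain a b where ab: "p j = (a, b)" by fastforce
    have "near_contracting (a, b)" using p j(1) ab by (auto simp: S_def T_def PiE_def Pi_def)
    moreover obtain x where x: "step p d j = (a + b + x, a)" "\<bar>x\<bar> \<le> 1"
      using d j(1) ab by (auto simp: step_def)
    ultimately have nc: "near_contracting (step p d j)"
      using near_contracting_step by simp
    with j(2) have "\<bar>fst (step p d j)\<bar> \<ge> D + 5" by (auto simp: T_def)
    with nc have "\<bar>s n (step p d) j\<bar> \<ge> int (fib (n + 3))"
      unfolding s_def using D0 D[OF j(1)] by (intro near_contracting_large) auto
    then show "of_nat (shift_corr J n (s n (step p d))) = (0 :: 'a)"
      using shift_corr_eq_0[OF J j(1)] by simp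
  qed
  moreover have "shift_corr J n (s n start) = shift_corr J n \<delta>" for n
    by (rule shift_corr_cong) (simp add: s_def start_def)
  ultimately show ?thesis by simp
qed

text \<open>Convergence in a discrete space would make the cardinalities of large finite sets
  constant, yet one more element raises them.\<close>

lemma infsum_nat_one: "infsum (\<lambda>_. 1 :: nat) (UNIV :: nat set) = 0"
proof (rule infsum_not_exists, rule notI)
  assume "(\<lambda>_. 1 :: nat) summable_on (UNIV :: nat set)"
  then obtain x where "((\<lambda>_. 1 :: nat) has_sum x) (UNIV :: nat set)"
    by (auto simp: summable_on_def)
  then have "eventually (\<lambda>A. sum (\<lambda>_. 1 :: nat) A = x) (finite_subsets_at_top (UNIV :: nat set))"
    unfolding has_sum_def by (simp add: tendsto_discrete)
  then obtain A :: "nat set" where A: "finite A"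
      and card: "\<And>B. finite B \<Longrightarrow> A \<subseteq> B \<Longrightarrow> card B = x"
    by (auto simp: eventually_finite_subsets_at_top)
  obtain y where "y \<notin> A" using A(1) ex_new_if_finite[OF infinite_UNIV_nat] by blast
  then have "card (insert y A) = Suc (card A)" using A(1) by simp
  then show False using A(1) card[of A] card[of "insert y A"] by auto
qed

section \<open>The original correlation\<close>

text \<open>
  The sum in \<open>fib_corr\<close> starts at \<open>k = 0\<close>; centred at the factor \<open>i0\<close> it misses the terms with
  \<open>z < i0\<close>, which are the ones added back here.
\<close>

lemma fib_corr_eq:
  assumes i0: "i0 < length \<alpha>" "\<alpha> ! i0 > 0"
  defines "J \<equiv> SIGMA i:{..<length \<alpha>}. {..<\<alpha> ! i - of_bool (i = i0)}"
    and "\<delta> \<equiv> \<lambda>(i, t::nat). int i - int i0"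
  shows "fib_corr \<alpha> n + (\<Sum>z\<in>{0..<int i0}.
      fib_coeff_int n z * (\<Prod>j\<in>J. fib_coeff_int n (z + \<delta> j))) = shift_corr J n \<delta>"
proof -
  define L where "L = fib (n + 3)"
  define g where "g = (\<lambda>z. fib_coeff_int n z * (\<Prod>j\<in>J. fib_coeff_int n (z + \<delta> j)))"
  have term_eq: "(\<Prod>i<length \<alpha>. fib_coeff n (k + i) ^ (\<alpha> ! i)) = g (int k + int i0)" for k
  proof -
    \<comment> \<open>\<open>J\<close> has \<open>\<alpha> ! i\<close> copies of each position
      \<open>i\<close>, less one of \<open>i0\<close>: that copy is the pinned factor.\<close>
    have "(\<Prod>j\<in>J. fib_coeff_int n (int k + int i0 + \<delta> j))
        = (\<Prod>i<length \<alpha>. \<Prod>t<\<alpha> ! i - of_bool (i = i0). fib_coeff n (k + i))"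
      unfolding J_def
      by (subst prod.Sigma) (auto intro!: prod.cong simp: \<delta>_def fib_coeff_int_def nat_add_distrib)
    also have "\<dots> = (\<Prod>i<length \<alpha>. fib_coeff n (k + i) ^ (\<alpha> ! i - of_bool (i = i0)))"
      by simp
    finally have "g (int k + int i0) = fib_coeff n (k + i0)
        * (\<Prod>i<length \<alpha>. fib_coeff n (k + i) ^ (\<alpha> ! i - of_bool (i = i0)))"
      unfolding g_def by (simp flip: of_nat_add)
    also have "\<dots> = (\<Prod>i<length \<alpha>. fib_coeff n (k + i) ^ (\<alpha> ! i))"
      using i0 by (simp add: prod.remove[of _ i0] power_eq_if[of _ "\<alpha> ! i0"])
    finally show ?thesis ..
  qed
  have g0: "g z = 0" if "z \<ge> int L" for z
    using that by (simp add: g_def fib_coeff_int_eq_0 L_def)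
  have "fib_corr \<alpha> n = infsum (\<lambda>k. g (int k + int i0)) {..<L}"
    unfolding fib_corr_def term_eq by (rule infsum_cong_neutral) (auto intro: g0)
  also have "\<dots> = (\<Sum>k<L. g (int k + int i0))" by simp
  also have "\<dots> = (\<Sum>z\<in>(\<lambda>k. int k + int i0) ` {..<L}. g z)"
    by (subst sum.reindex) (auto simp: inj_on_def)
  also have "(\<lambda>k. int k + int i0) ` {..<L} = {int i0..<int (L + i0)}"
  proof safe
    fix z assume "z \<in> {int i0..<int (L + i0)}"
    then show "z \<in> (\<lambda>k. int k + int i0) ` {..<L}"
      by (intro image_eqI[of _ _ "nat (z - int i0)"]) auto
  qed auto
  finally have fc: "fib_corr \<alpha> n = (\<Sum>z\<in>{int i0..<int (L + i0)}. g z)" .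
  have "shift_corr J n \<delta> = (\<Sum>z\<in>{0..<int (L + i0)}. g z)"
    unfolding g_def by (rule shift_corr_superset) (auto simp: L_def)
  also have "{0..<int (L + i0)} = {0..<int i0} \<union> {int i0..<int (L + i0)}" by auto
  also have "(\<Sum>z\<in>\<dots>. g z) = (\<Sum>z\<in>{0..<int i0}. g z) + fib_corr \<alpha> n"
    unfolding fc by (rule sum.union_disjoint) auto
  finally show ?thesis by (simp add: g_def)
qed

theorem theorem5:
  fixes \<alpha> :: "nat list"
  shows "rational_fps (fib_corr_gf \<alpha>)"
proof (cases "\<exists>i<length \<alpha>. \<alpha> ! i > 0")
  case False
  \<comment> \<open>All exponents are 0, so every term is 1 and the divergent sum takes its default
    value 0.\<close>
  then have "fib_corr \<alpha> n = 0" for n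
    using infsum_nat_one by (simp add: fib_corr_def)
  then show ?thesis
    unfolding fib_corr_gf_def by (intro rational_fps_eventually_const[of 0 _ 0]) simp
next
  case True
  then obtain i0 where i0: "i0 < length \<alpha>" "\<alpha> ! i0 > 0" by blast
  define J where "J = (SIGMA i:{..<length \<alpha>}. {..<\<alpha> ! i - of_bool (i = i0)})"
  define \<delta> where "\<delta> = (\<lambda>(i, t::nat). int i - int i0)"
  define h where "h n = (\<Sum>z\<in>{0..<int i0}.
      fib_coeff_int n z * (\<Prod>j\<in>J. fib_coeff_int n (z + \<delta> j)))" for n
  have J: "finite J" by (simp add: J_def)
  have "fib_corr \<alpha> n + h n = shift_corr J n \<delta>" for n
    using fib_corr_eq[OF i0] by (simp add: h_def J_def \<delta>_def)
  then have "(of_nat (fib_corr \<alpha> n) :: rat) = of_nat (shift_corr J n \<delta>) - of_nat (h n)" for n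
    by (metis add_diff_cancel_right' of_nat_add)
  then have eq: "fib_corr_gf \<alpha>
      = Abs_fps (\<lambda>n. of_nat (shift_corr J n \<delta>)) - Abs_fps (\<lambda>n. of_nat (h n))"
    unfolding fib_corr_gf_def by (simp add: fps_eq_iff)
  \<comment> \<open>All indices \<open>z\<close> and \<open>z + \<delta> j\<close> are below
    \<open>length \<alpha>\<close>, where coefficients have stabilised, so the right side is free of
    \<open>n\<close>.\<close>
  have "h n = (\<Sum>z\<in>{0..<int i0}.
      fib_coeff_int (nat z) z * (\<Prod>j\<in>J. fib_coeff_int (nat (z + \<delta> j)) (z + \<delta> j)))"
    if n: "n \<ge> length \<alpha>" for n
    unfolding h_def
  proof (intro sum.cong refl arg_cong2[of _ _ _ _ "(*)"] prod.cong)
    fix z assume z: "z \<in> {0..<int i0}"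
    then show "fib_coeff_int n z = fib_coeff_int (nat z) z"
      using i0 n by (intro fib_coeff_int_stable) simp
    fix j assume "j \<in> J"
    then show "fib_coeff_int n (z + \<delta> j) = fib_coeff_int (nat (z + \<delta> j)) (z + \<delta> j)"
      using z n by (intro fib_coeff_int_stable) (auto simp: J_def \<delta>_def)
  qed
  then have "rational_fps (Abs_fps (\<lambda>n. of_nat (h n) :: rat))"
    by (intro rational_fps_eventually_const[of "length \<alpha>"]) simp
  then show ?thesis
    unfolding eq by (intro rational_fps_diff rational_fps_shift_corr J)
qed

end
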